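(* Let $\mathcal{D}$ be a set of (disjoint self-avoiding) curves without endpoints in $\mathbb{R}^3$ such that $\Gamma^n(\mathcal{D})$ is defined for each $n\in\mathbb{N}$. Then $\mathcal{D}$ consists of at most $27$ curves.
   Context: Curves. Let $(e_1,e_2,e_3)$ be the canonical basis of $\mathbb{R}^3$. A segment is a non-oriented interval $[x,x+e_i]$ with $x\in\mathbb{Z}^3$. A curve is a nonoriented sequence of segments, finite or indexed by $\mathbb{N}$ or by $\mathbb{Z}$, such that (i) two consecutive segments have one and only one common endpoint, and (ii) the common endpoints of a segment with the preceding one and with the following one, when these exist, are different. A curve is without endpoints if it is indexed by $\mathbb{Z}$. A curve is self-avoiding if each of its segments appears only once; curves are disjoint if they have no common segment. A set of self-avoiding curves is a covering of $\mathbb{R}^3$ if each segment appears in one and only one of its curves. The covering $\mathcal{C}$. Write $\overline{m}=-m$. Let $\mathcal{B}_0$ be the set of the $6$ curves with successive vertices $((0,0,0),(0,\overline{1},0),(0,\overline{1},\overline{1}),(0,0,\overline{1}),(1,0,\overline{1}),(1,\overline{1},\overline{1}),(1,\overline{1},0),(1,0,0),(2,0,0))$, $((0,0,0),(0,0,1),(0,1,1),(0,1,0),(\overline{1},1,0),(\overline{1},1,1),(\overline{1},0,1),(\overline{1},0,0),(\overline{2},0,0))$, $((0,0,0),(0,0,\overline{1}),(\overline{1},0,\overline{1}),(\overline{1},0,0),(\overline{1},1,0),(\overline{1},1,\overline{1}),(0,1,\overline{1}),(0,1,0),(0,2,0))$, $((0,0,0),(1,0,0),(1,0,1),(0,0,1),(0,\overline{1},1),(1,\overline{1},1),(1,\overline{1},0),(0,\overline{1},0),(0,\overline{2},0))$,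 $((0,0,0),(\overline{1},0,0),(\overline{1},\overline{1},0),(0,\overline{1},0),(0,\overline{1},1),(\overline{1},\overline{1},1),(\overline{1},0,1),(0,0,1),(0,0,2))$, $((0,0,0),(0,1,0),(1,1,0),(1,0,0),(1,0,\overline{1}),(1,1,\overline{1}),(0,1,\overline{1}),(0,0,\overline{1}),(0,0,\overline{2}))$. Let $\mathcal{B}_1,\mathcal{B}_2,\mathcal{B}_3$ be the images of $\mathcal{B}_0$ by the isometries $(a,b,c)\mapsto(2+a,2-b,-c)$, $(a,b,c)\mapsto(2-a,-b,2+c)$, $(a,b,c)\mapsto(-a,2+b,2-c)$ respectively. $\mathcal{C}$ is the set of all translates $4u+D$ with $u\in\mathbb{Z}^3$ and $D\in\mathcal{B}_0\cup\mathcal{B}_1\cup\mathcal{B}_2\cup\mathcal{B}_3$. It is a covering of $\mathbb{R}^3$; each of its curves joins two points $2x,2x+2e_i$ ($x\in\mathbb{Z}^3$), and any two such points are joined by a unique curve of $\mathcal{C}$. The operations $\Delta$ and $\Gamma$. For a set $\mathcal{D}$ of disjoint self-avoiding curves, $\Delta(\mathcal{D})=\mathcal{C}\ast\mathcal{D}$ is the set of disjoint self-avoiding curves obtained by applying to $\mathcal{D}$ the homothety of center $0$ and ratio $2$, then replacing each resulting interval by the curve of $\mathcal{C}$ with the same endpoints. $\Gamma$ is the inverse operation: it is defined on the sets of the form $\Delta(\mathcal{D})$ and $\Gamma(\Delta(\mathcal{D}))=\mathcal{D}$ (in $\Delta(\mathcal{D})$, replace each piece of curve with endpoints in $2\mathbb{Z}^3$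 consisting of $8$ segments by the interval which joins its endpoints, then apply the homothety of center $0$ and ratio $1/2$). $\Gamma^n$ is the $n$-th iterate, so $\Gamma^n(\mathcal{D})$ is defined iff $\mathcal{D}=\Delta^n(\mathcal{D}')$ for some set $\mathcal{D}'$ of disjoint self-avoiding curves. *)

theory Defs
  imports Main "HOL-Library.Product_Plus"
begin

type_synonym point = "int \<times> int \<times> int"

text \<open>The interval \<open>[x, x + e\<^sub>i]\<close> is represented by the set of its two endpoints.\<close>

type_synonym segment = "point set"

definition is_segment :: "segment \<Rightarrow> bool" where
  "is_segment s \<longleftrightarrow> (\<exists>x. \<exists>e \<in> {(1, 0, 0), (0, 1, 0), (0, 0, 1)}. s = {x, x + e})"

text \<open>A sequence of segments is a partial map on \<open>int\<close> whose domain is the index set.\<close>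

definition curve_seq :: "(int \<rightharpoonup> segment) \<Rightarrow> bool" where
  "curve_seq f \<longleftrightarrow>
     ((\<exists>n \<ge> 1. dom f = {0..<int n}) \<or> dom f = {0..} \<or> dom f = UNIV) \<and>
     (\<forall>s \<in> ran f. is_segment s) \<and>
     (\<forall>i s t. f i = Some s \<longrightarrow> f (i + 1) = Some t \<longrightarrow> (\<exists>!p. p \<in> s \<inter> t)) \<and>
     (\<forall>i r s t p q. f (i - 1) = Some r \<longrightarrow> f i = Some s \<longrightarrow> f (i + 1) = Some t \<longrightarrow>
        p \<in> r \<inter> s \<longrightarrow> q \<in> s \<inter> t \<longrightarrow> p \<noteq> q)"

text \<open>Curves are not oriented, and the position of the index 0 in a sequence indexed by
  all integers is immaterial. A curve is therefore the class of all the reindexings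
  \<open>i \<mapsto> \<plusminus>i + a\<close> of a sequence. The class of a sequence indexed by
  \<open>{0..<n}\<close> or by \<open>{0..}\<close> also contains copies with translated or reflected domains.\<close>

type_synonym curve = "(int \<rightharpoonup> segment) set"

definition curve_of :: "(int \<rightharpoonup> segment) \<Rightarrow> curve" where
  "curve_of f = {(\<lambda>i. f (c * i + a)) | c a. c \<in> {1, -1}}"

definition is_curve :: "curve \<Rightarrow> bool" where
  "is_curve K \<longleftrightarrow> (\<exists>f. curve_seq f \<and> K = curve_of f)"

definition segments :: "curve \<Rightarrow> segment set" where
  "segments K = (\<Union>f \<in> K. ran f)"

definition self_avoiding :: "curve \<Rightarrow> bool" where
  "self_avoiding K \<longleftrightarrow> (\<forall>f \<in> K. inj_on f (dom f))"

definition without_endpoints :: "curve \<Rightarrow> bool" where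
  "without_endpoints K \<longleftrightarrow> (\<exists>f \<in> K. dom f = UNIV)"

definition disjoint_self_avoiding :: "curve set \<Rightarrow> bool" where
  "disjoint_self_avoiding D \<longleftrightarrow>
     (\<forall>K \<in> D. is_curve K \<and> self_avoiding K) \<and>
     pairwise (\<lambda>K L. segments K \<inter> segments L = {}) D"

definition curve_of_vertices :: "point list \<Rightarrow> curve" where
  "curve_of_vertices vs =
     curve_of (\<lambda>i. if 0 \<le> i \<and> i + 1 < int (length vs)
                   then Some {vs ! nat i, vs ! nat (i + 1)} else None)"

definition map_curve :: "(point \<Rightarrow> point) \<Rightarrow> curve \<Rightarrow> curve" where
  "map_curve h K = (\<lambda>f i. map_option (image h) (f i)) ` K"

definition scale :: "int \<Rightarrow> point \<Rightarrow> point" where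
  "scale m = (\<lambda>(a, b, c). (m * a, m * b, m * c))"

definition B0 :: "curve set" where
  "B0 = curve_of_vertices `
    {[(0,0,0), (0,-1,0), (0,-1,-1), (0,0,-1), (1,0,-1), (1,-1,-1), (1,-1,0), (1,0,0), (2,0,0)],
     [(0,0,0), (0,0,1), (0,1,1), (0,1,0), (-1,1,0), (-1,1,1), (-1,0,1), (-1,0,0), (-2,0,0)],
     [(0,0,0), (0,0,-1), (-1,0,-1), (-1,0,0), (-1,1,0), (-1,1,-1), (0,1,-1), (0,1,0), (0,2,0)],
     [(0,0,0), (1,0,0), (1,0,1), (0,0,1), (0,-1,1), (1,-1,1), (1,-1,0), (0,-1,0), (0,-2,0)],
     [(0,0,0), (-1,0,0), (-1,-1,0), (0,-1,0), (0,-1,1), (-1,-1,1), (-1,0,1), (0,0,1), (0,0,2)],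
     [(0,0,0), (0,1,0), (1,1,0), (1,0,0), (1,0,-1), (1,1,-1), (0,1,-1), (0,0,-1), (0,0,-2)]}"

definition B1 :: "curve set" where
  "B1 = map_curve (\<lambda>(a, b, c). (2 + a, 2 - b, - c)) ` B0"

definition B2 :: "curve set" where
  "B2 = map_curve (\<lambda>(a, b, c). (2 - a, - b, 2 + c)) ` B0"

definition B3 :: "curve set" where
  "B3 = map_curve (\<lambda>(a, b, c). (- a, 2 + b, 2 - c)) ` B0"

definition covering_C :: "curve set" where
  "covering_C = {map_curve (\<lambda>x. scale 4 u + x) K | u K. K \<in> B0 \<union> B1 \<union> B2 \<union> B3}"

definition has_vertices :: "(int \<rightharpoonup> segment) \<Rightarrow> (int \<Rightarrow> point) \<Rightarrow> bool" where
  "has_vertices f v \<longleftrightarrow> (\<forall>i \<in> dom f. f i = Some {v i, v (i + 1)})"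

definition runs_from_to :: "(int \<rightharpoonup> segment) \<Rightarrow> nat \<Rightarrow> point \<Rightarrow> point \<Rightarrow> bool" where
  "runs_from_to f n p q \<longleftrightarrow>
     dom f = {0..<int n} \<and> (\<exists>v. has_vertices f v \<and> v 0 = p \<and> v (int n) = q)"

text \<open>\<open>substitutes f g\<close>: the sequence \<open>g\<close> arises from \<open>f\<close> by doubling each segment and
  replacing it by the curve of the covering with the same endpoints, traversed in the
  direction in which \<open>f\<close> traverses the segment. Each curve of the covering has 8 segments,
  so the \<open>j\<close>-th segment of \<open>f\<close> becomes the block of \<open>g\<close> with indices \<open>8 * j, \<dots>, 8 * j + 7\<close>.\<close>

definition substitutes :: "(int \<rightharpoonup> segment) \<Rightarrow> (int \<rightharpoonup> segment) \<Rightarrow> bool" where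
  "substitutes f g \<longleftrightarrow>
     dom g = {i. i div 8 \<in> dom f} \<and>
     (\<exists>v. has_vertices f v \<and>
        (\<forall>j \<in> dom f.
           let b = (\<lambda>k. g (8 * j + k)) |` {0..<8}
           in (\<exists>K \<in> covering_C. b \<in> K) \<and>
              runs_from_to b 8 (scale 2 (v j)) (scale 2 (v (j + 1)))))"

definition Delta :: "curve set \<Rightarrow> curve set" where
  "Delta D = {curve_of g | K f g. K \<in> D \<and> f \<in> K \<and> substitutes f g}"

text \<open>The partial operation \<open>\<Gamma>\<close> is given by its graph: \<open>Gamma D E\<close> means that
  \<open>\<Gamma>(D)\<close> is defined and equal to \<open>E\<close>. Its iterates are relational powers.\<close>

inductive Gamma :: "curve set \<Rightarrow> curve set \<Rightarrow> bool" where
  "disjoint_self_avoiding D \<Longrightarrow> Gamma (Delta D) D"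

definition Gamma_iterate_defined :: "nat \<Rightarrow> curve set \<Rightarrow> bool" where
  "Gamma_iterate_defined n D \<longleftrightarrow> (\<exists>E. (Gamma ^^ n) D E)"

end

theory Submission imports Defs begin

text \<open>Let \<open>m(s)\<close> be the sum of the endpoints of a segment \<open>s\<close>. If \<open>t\<close> belongs to the curve of \<open>\<C>\<close>
  that replaces the doubled segment \<open>s\<close>, then \<open>m(t)\<close> differs from \<open>2m(s)\<close> by at most 2 in each
  coordinate. Passing to ancestors under \<open>\<Gamma>\<close> thus brings every segment into the cube \<open>[-1,1]\<^sup>3\<close>, and
  a finite check shows that two further steps bring it to the origin, where \<open>m(s)\<close> is a unit
  vector. So for \<open>n\<close> large all curves of a given finite part of \<open>\<D>\<close> have ancestors under
  \<open>\<Gamma>\<^sup>n\<close> that contain a segment with \<open>m(s) \<in> {-1,0,1}\<^sup>3\<close>. The ancestors of different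
  curves are disjoint, and \<open>m\<close> is injective on segments.\<close>

section \<open>Segments of a curve, independently of its indexing\<close>

lemma ran_reindex:
  fixes f :: "int \<rightharpoonup> 'a"
  assumes "c \<in> {1, -1}"
  shows "ran (\<lambda>i. f (c * i + a)) = ran f"
proof -
  have "c * (c * (i - a)) + a = i" for i
    using assms by auto
  then have "surj (\<lambda>i. c * i + a)"
    by (rule surjI[of "\<lambda>i. c * i + a" "\<lambda>i. c * (i - a)"])
  then have "range (\<lambda>i. f (c * i + a)) = range f"
    by (metis image_image)
  moreover have "ran g = {t. Some t \<in> range g}" for g :: "int \<rightharpoonup> 'a"
    unfolding ran_def image_def by (auto simp: eq_commute)
  ultimately show ?thesis
    by presburger
qed

lemma segments_curve_of: "segments (curve_of f) = ran f"
proof -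
  have f: "f \<in> curve_of f"
    unfolding curve_of_def by (rule CollectI, rule exI[of _ 1], rule exI[of _ 0]) simp
  have ran: "ran g = ran f" if g: "g \<in> curve_of f" for g
  proof -
    obtain c a where "c \<in> {1, -1}" "g = (\<lambda>i. f (c * i + a))"
      using g unfolding curve_of_def by blast
    then show ?thesis
      using ran_reindex[of c f a] by simp
  qed
  have "curve_of f \<noteq> {}"
    using f by blast
  then show ?thesis
    unfolding segments_def using ran by (rule SUP_eq_const)
qed

lemma ran_eq_segments:
  assumes "is_curve K" "f \<in> K"
  shows "ran f = segments K"
proof -
  obtain h where h: "K = curve_of h"
    using assms(1) is_curve_def by blast
  with assms(2) obtain c a where "c \<in> {1, -1}" "f = (\<lambda>i. h (c * i + a))"
    unfolding curve_of_def by blast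
  then show ?thesis
    using h ran_reindex segments_curve_of by simp
qed

lemma segments_is_segment:
  assumes "is_curve K" "s \<in> segments K"
  shows "is_segment s"
  using assms segments_curve_of unfolding is_curve_def curve_seq_def by metis

lemma segments_nonempty:
  assumes "is_curve K"
  shows "segments K \<noteq> {}"
proof -
  obtain f where f: "curve_seq f" "K = curve_of f"
    using assms is_curve_def by blast
  then have "0 \<in> dom f"
    unfolding curve_seq_def by auto
  then show ?thesis
    using f(2) segments_curve_of unfolding ran_def by auto
qed

lemma curve_with_segment_unique:
  assumes "disjoint_self_avoiding D" "K \<in> D" "L \<in> D" "s \<in> segments K" "s \<in> segments L"
  shows "K = L"
  using assms unfolding disjoint_self_avoiding_def pairwise_def by blast

section \<open>The covering as 24 vertex paths up to translation\<close>

definition base_paths :: "point list list" where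
  "base_paths =
    [[(0,0,0), (0,-1,0), (0,-1,-1), (0,0,-1), (1,0,-1), (1,-1,-1), (1,-1,0), (1,0,0), (2,0,0)],
     [(0,0,0), (0,0,1), (0,1,1), (0,1,0), (-1,1,0), (-1,1,1), (-1,0,1), (-1,0,0), (-2,0,0)],
     [(0,0,0), (0,0,-1), (-1,0,-1), (-1,0,0), (-1,1,0), (-1,1,-1), (0,1,-1), (0,1,0), (0,2,0)],
     [(0,0,0), (1,0,0), (1,0,1), (0,0,1), (0,-1,1), (1,-1,1), (1,-1,0), (0,-1,0), (0,-2,0)],
     [(0,0,0), (-1,0,0), (-1,-1,0), (0,-1,0), (0,-1,1), (-1,-1,1), (-1,0,1), (0,0,1), (0,0,2)],
     [(0,0,0), (0,1,0), (1,1,0), (1,0,0), (1,0,-1), (1,1,-1), (0,1,-1), (0,0,-1), (0,0,-2)]]"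

text \<open>Unlike classes of partial maps, vertex lists can be evaluated, so the finite checks
  below run by \<open>code_simp\<close>.\<close>

definition template_paths :: "point list list" where
  "template_paths =
     base_paths @
     map (map (\<lambda>(a, b, c). (2 + a, 2 - b, - c))) base_paths @
     map (map (\<lambda>(a, b, c). (2 - a, - b, 2 + c))) base_paths @
     map (map (\<lambda>(a, b, c). (- a, 2 + b, 2 - c))) base_paths"

lemma map_curve_of_vertices:
  "map_curve h (curve_of_vertices vs) = curve_of_vertices (map h vs)"
proof -
  have eq: "map_curve h (curve_of f) = curve_of (\<lambda>i. map_option (image h) (f i))" for f
  proof -
    have "curve_of g = (\<lambda>(c, a) i. g (c * i + a)) ` ({1, -1} \<times> UNIV)" for g
      unfolding curve_of_def by auto
    then show ?thesis
      unfolding map_curve_def by (simp add: image_image case_prod_beta)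
  qed
  show ?thesis
    unfolding curve_of_vertices_def eq
    by (rule arg_cong[of _ _ curve_of]) (auto simp: fun_eq_iff nat_less_iff)
qed

lemma covering_C_cases:
  assumes "K \<in> covering_C"
  obtains u vs where "vs \<in> set template_paths" "K = curve_of_vertices (map ((+) (scale 4 u)) vs)"
proof -
  have B0: "B0 = curve_of_vertices ` set base_paths"
    unfolding B0_def base_paths_def by simp
  have templates: "B0 \<union> B1 \<union> B2 \<union> B3 = curve_of_vertices ` set template_paths"
    unfolding B1_def B2_def B3_def B0 template_paths_def
    by (simp add: image_Un image_image map_curve_of_vertices Un_assoc)
  obtain u L where "K = map_curve ((+) (scale 4 u)) L" "L \<in> B0 \<union> B1 \<union> B2 \<union> B3"
    using assms unfolding covering_C_def by blast
  then show ?thesis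
    using that map_curve_of_vertices unfolding templates by blast
qed

lemma template_paths_distinct:
  assumes "vs \<in> set template_paths"
  shows "length vs = 9" "distinct vs"
proof -
  have "list_all (\<lambda>vs. length vs = 9 \<and> distinct vs) template_paths"
    by code_simp
  then show "length vs = 9" "distinct vs"
    using assms by (auto simp: list_all_iff)
qed

section \<open>Recovering vertices from edges\<close>

definition edges :: "'a list \<Rightarrow> 'a set set" where
  "edges ws = {{ws ! k, ws ! Suc k} | k. Suc k < length ws}"

text \<open>Since \<open>w\<close> is injective, \<open>w 0\<close> is not on the second edge, so
  the first two edges fix the orientation. After that, each edge and its known endpoint determine
  the next vertex.\<close>

lemma same_edges_same_vertices:
  fixes v w :: "nat \<Rightarrow> 'a"
  assumes edge: "\<And>i. i < n \<Longrightarrow> {v i, v (Suc i)} = {w i, w (Suc i)}"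
    and inj: "inj_on w {..n}" and "2 \<le> n" "i \<le> n"
  shows "v i = w i"
  using \<open>i \<le> n\<close>
proof (induction i)
  case 0
  have "w 0 \<noteq> w 1" "w 0 \<noteq> w 2"
    using inj_on_eq_iff[OF inj, of 0 1] inj_on_eq_iff[OF inj, of 0 2] \<open>2 \<le> n\<close> by simp_all
  then show ?case
    using edge[of 0] edge[of 1] \<open>2 \<le> n\<close> by (auto simp: doubleton_eq_iff numeral_2_eq_2)
next
  case (Suc i)
  then show ?case
    using edge[of i] by (auto simp: doubleton_eq_iff)
qed

text \<open>The vertex sequence in \<open>runs_from_to\<close> is only asserted to exist. The edges
  determine it, and the unordered pair of endpoints is the same for a path and its reversal.\<close>

lemma runs_from_to_path:
  assumes b: "b \<in> curve_of_vertices ws" and "length ws = Suc n" "distinct ws" "2 \<le> n"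
    and runs: "runs_from_to b n p q"
  shows "{p, q} = {ws ! 0, ws ! n}" and "ran b = edges ws"
proof -
  define F where "F = (\<lambda>i. if 0 \<le> i \<and> i + 1 < int (length ws)
    then Some {ws ! nat i, ws ! nat (i + 1)} else None)"
  obtain c a where ca: "c \<in> {1, -1}" "b = (\<lambda>i. F (c * i + a))"
    using b unfolding curve_of_vertices_def curve_of_def F_def by blast
  have F: "F (int k) = Some {ws ! k, ws ! Suc k}" if "k < n" for k
    using that assms(2) unfolding F_def by (auto simp: nat_add_distrib)
  have "ran F = edges ws"
  proof
    show "ran F \<subseteq> edges ws"
    proof
      fix t assume "t \<in> ran F"
      then obtain i where i: "F i = Some t"
        unfolding ran_def by blast
      then have "0 \<le> i" "i < int n"
        unfolding F_def using assms(2) by (auto split: if_splits)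
      then show "t \<in> edges ws"
        using F[of "nat i"] i assms(2) unfolding edges_def by auto
    qed
    show "edges ws \<subseteq> ran F"
    proof
      fix t assume "t \<in> edges ws"
      then obtain k where "t = {ws ! k, ws ! Suc k}" "k < n"
        using assms(2) unfolding edges_def by auto
      then show "t \<in> ran F"
        using F ranI by metis
    qed
  qed
  then show "ran b = edges ws"
    using ran_reindex[OF ca(1), of F a] ca(2) by simp
  have domF: "F i \<noteq> None \<longleftrightarrow> 0 \<le> i \<and> i < int n" for i
    unfolding F_def using assms(2) by auto
  obtain v where v: "has_vertices b v" "v 0 = p" "v (int n) = q" and "dom b = {0..<int n}"
    using runs unfolding runs_from_to_def by blast
  then have dom: "0 \<le> c * i + a \<and> c * i + a < int n \<longleftrightarrow> 0 \<le> i \<and> i < int n" for i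
    using domF[of "c * i + a"] ca(2) by auto
  have bv: "b (int i) = Some {v (int i), v (int (Suc i))}" if "i < n" for i
    using v(1) \<open>dom b = _\<close> that unfolding has_vertices_def by (auto simp: add.commute)
  have inj: "inj_on ((!) ws) {..n}"
    using \<open>distinct ws\<close> assms(2) by (auto simp: inj_on_def nth_eq_iff_index_eq)
  \<comment> \<open>The reindexing maps both 0 and \<open>n - 1\<close> into \<open>{0..<n}\<close>,
    which leaves the identity and the reversal.\<close>
  consider "c = 1" "a = 0" | "c = -1" "a = int n - 1"
    using ca(1) dom[of 0] dom[of "int n - 1"] \<open>2 \<le> n\<close> by fastforce
  then show "{p, q} = {ws ! 0, ws ! n}"
  proof cases
    case 1
    have "{v (int i), v (int (Suc i))} = {ws ! i, ws ! Suc i}" if "i < n" for i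
      using F[OF that] bv[OF that] ca(2) 1 by simp
    then have "v (int i) = ws ! i" if "i \<le> n" for i
      using same_edges_same_vertices[of n "\<lambda>i. v (int i)" "(!) ws" i] inj that \<open>2 \<le> n\<close> by blast
    from this[of 0] this[of n] show ?thesis
      using v by simp
  next
    case 2
    have "{v (int i), v (int (Suc i))} = {ws ! (n - i), ws ! (n - Suc i)}" if "i < n" for i
    proof -
      have "c * int i + a = int (n - Suc i)" "Suc (n - Suc i) = n - i"
        using that 2 by auto
      then show ?thesis
        using F[of "n - Suc i"] bv[OF that] ca(2) that by (simp add: insert_commute)
    qed
    moreover have "inj_on (\<lambda>i. ws ! (n - i)) {..n}"
      using inj by (fastforce simp: inj_on_def)
    ultimately have "v (int i) = ws ! (n - i)" if "i \<le> n" for i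
      using same_edges_same_vertices[of n "\<lambda>i. v (int i)" "\<lambda>i. ws ! (n - i)" i] that \<open>2 \<le> n\<close>
      by blast
    from this[of 0] this[of n] show ?thesis
      using v by auto
  qed
qed

section \<open>Parent and child segments\<close>

text \<open>\<open>path_over s ws\<close> means that \<open>ws\<close> lists the vertices of the curve of \<open>\<C>\<close> that replaces
  the doubled segment \<open>s\<close>.\<close>

definition path_over :: "segment \<Rightarrow> point list \<Rightarrow> bool" where
  "path_over s ws \<longleftrightarrow> (\<exists>u vs. vs \<in> set template_paths \<and> ws = map ((+) (scale 4 u)) vs \<and>
     scale 2 ` s = {ws ! 0, ws ! 8})"

definition child :: "segment \<Rightarrow> segment \<Rightarrow> bool" where
  "child s t \<longleftrightarrow> (\<exists>ws. path_over s ws \<and> t \<in> edges ws)"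

lemma path_over_distinct:
  assumes "path_over s ws"
  shows "length ws = 9" "distinct ws"
  using assms template_paths_distinct unfolding path_over_def
  by (auto simp: distinct_map inj_on_def)

text \<open>Twice the midpoint.\<close>

definition mid2 :: "segment \<Rightarrow> point" where
  "mid2 s = (\<Sum>p\<in>s. p)"

lemma mid2_doubleton: "p \<noteq> q \<Longrightarrow> mid2 {p, q} = p + q"
  unfolding mid2_def by simp

lemma scale_add: "scale m (p + q) = scale m p + scale m q"
  unfolding scale_def by (cases p; cases q) (simp add: algebra_simps)

lemma scale_scale: "scale m (scale n p) = scale (m * n) p"
  unfolding scale_def by (cases p) simp

lemma inj_scale: "m \<noteq> 0 \<Longrightarrow> inj (scale m)"
  unfolding scale_def by (auto intro!: injI)

lemma mid2_scale:
  assumes "m \<noteq> 0"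
  shows "mid2 (scale m ` s) = scale m (mid2 s)"
proof -
  have "scale m 0 = 0"
    unfolding scale_def zero_prod_def by simp
  moreover have "inj_on (scale m) s"
    using inj_scale[OF assms] inj_on_subset by blast
  ultimately show ?thesis
    unfolding mid2_def using sum_comp_morphism[of "scale m" "\<lambda>p. p" s]
    by (simp add: sum.reindex scale_add comp_def)
qed

lemma scale_two: "scale 2 p = p + p"
  unfolding scale_def by (cases p) simp

lemma mid2_path_over:
  assumes "vs \<in> set template_paths" "ws = map ((+) (scale 4 u)) vs"
    "scale 2 ` s = {ws ! 0, ws ! 8}"
  shows "scale 2 (mid2 s) = scale 8 u + (vs ! 0 + vs ! 8)"
proof -
  have "ws ! 0 \<noteq> ws ! 8"
    using template_paths_distinct[OF assms(1)] assms(2) by (simp add: nth_eq_iff_index_eq)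
  then have "scale 2 (mid2 s) = ws ! 0 + ws ! 8"
    using mid2_doubleton mid2_scale[of 2 s] assms(3) by simp
  also have "\<dots> = (scale 4 u + scale 4 u) + (vs ! 0 + vs ! 8)"
    using template_paths_distinct(1)[OF assms(1)] assms(2) by (simp add: add_ac)
  finally show ?thesis
    using scale_two[of "scale 4 u"] by (simp add: scale_scale)
qed

fun residue8 :: "point \<Rightarrow> point" where
  "residue8 (a, b, c) = (a mod 8, b mod 8, c mod 8)"

lemma residue8_shift: "residue8 (scale 8 u + p) = residue8 p"
  unfolding scale_def by (cases u; cases p) simp

text \<open>At most one curve of \<open>\<C>\<close> joins two given points: translations by \<open>4u\<close> do not change
  the sum of the endpoints modulo 8, and the 24 templates have different residues.\<close>

lemma path_over_unique:
  assumes "path_over s ws" "path_over s ws'"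
  shows "ws = ws'"
proof -
  obtain u vs where 1: "vs \<in> set template_paths" "ws = map ((+) (scale 4 u)) vs"
    "scale 2 ` s = {ws ! 0, ws ! 8}"
    using assms(1) path_over_def by blast
  obtain u' vs' where 2: "vs' \<in> set template_paths" "ws' = map ((+) (scale 4 u')) vs'"
    "scale 2 ` s = {ws' ! 0, ws' ! 8}"
    using assms(2) path_over_def by blast
  have eq: "scale 8 u + (vs ! 0 + vs ! 8) = scale 8 u' + (vs' ! 0 + vs' ! 8)"
    using mid2_path_over[OF 1] mid2_path_over[OF 2] by simp
  then have "residue8 (vs ! 0 + vs ! 8) = residue8 (vs' ! 0 + vs' ! 8)"
    by (metis residue8_shift)
  moreover have "distinct (map (\<lambda>vs. residue8 (vs ! 0 + vs ! 8)) template_paths)"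
    by code_simp
  ultimately have "vs = vs'"
    using 1(1) 2(1) by (auto simp: distinct_map inj_on_def)
  with eq have "u = u'"
    using inj_scale[of 8] by (simp add: inj_eq)
  with \<open>vs = vs'\<close> show ?thesis
    using 1(2) 2(2) by simp
qed

section \<open>Ancestors under \<open>Gamma\<close>\<close>

lemma substitutes_block:
  assumes "substitutes f g" "f j = Some s"
  obtains ws where "path_over s ws" "ran ((\<lambda>k. g (8 * j + k)) |` {0..<8}) = edges ws"
proof -
  define b where "b = (\<lambda>k. g (8 * j + k)) |` {0..<8}"
  obtain v where "has_vertices f v"
    and "(\<exists>K \<in> covering_C. b \<in> K) \<and> runs_from_to b 8 (scale 2 (v j)) (scale 2 (v (j + 1)))"
    using assms unfolding substitutes_def Let_def b_def by blast
  then obtain K where K: "K \<in> covering_C" "b \<in> K"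
    and runs: "runs_from_to b 8 (scale 2 (v j)) (scale 2 (v (j + 1)))"
    by blast
  have s: "s = {v j, v (j + 1)}"
    using \<open>has_vertices f v\<close> assms(2) unfolding has_vertices_def by force
  obtain u vs where vs: "vs \<in> set template_paths"
    "K = curve_of_vertices (map ((+) (scale 4 u)) vs)"
    using K(1) covering_C_cases by blast
  define ws where "ws = map ((+) (scale 4 u)) vs"
  have "length ws = Suc 8" "distinct ws"
    using template_paths_distinct[OF vs(1)] unfolding ws_def
    by (auto simp: distinct_map inj_on_def)
  note block = runs_from_to_path[OF _ this _ runs]
  have "scale 2 ` s = {ws ! 0, ws ! 8}"
    using block(1) K(2) vs(2) s unfolding ws_def by simp
  then have "path_over s ws"
    using vs(1) ws_def path_over_def by blast
  moreover have "ran b = edges ws"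
    using block(2) K(2) vs(2) unfolding ws_def by simp
  ultimately show ?thesis
    using that b_def by blast
qed

lemma ran_substitutes:
  assumes "substitutes f g"
  shows "ran g = {t. \<exists>s \<in> ran f. child s t}"
proof (intro set_eqI iffI)
  fix t assume "t \<in> ran g"
  then obtain i where i: "g i = Some t"
    unfolding ran_def by blast
  then obtain s where s: "f (i div 8) = Some s"
    using assms unfolding substitutes_def by blast
  have "((\<lambda>k. g (8 * (i div 8) + k)) |` {0..<8}) (i mod 8) = Some t"
    using i by simp
  then have "t \<in> ran ((\<lambda>k. g (8 * (i div 8) + k)) |` {0..<8})"
    by (rule ranI)
  then have "child s t"
    using substitutes_block[OF assms s] unfolding child_def by metis
  then show "t \<in> {t. \<exists>s \<in> ran f. child s t}"
    using s by (auto intro: ranI)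
next
  fix t assume "t \<in> {t. \<exists>s \<in> ran f. child s t}"
  then obtain s j where s: "f j = Some s" "child s t"
    unfolding ran_def by blast
  obtain ws where "path_over s ws" "ran ((\<lambda>k. g (8 * j + k)) |` {0..<8}) = edges ws"
    using substitutes_block[OF assms s(1)] by blast
  \<comment> \<open>The path witnessing \<open>child s t\<close> must be the one used in the block,
    by uniqueness.\<close>
  then have "t \<in> ran ((\<lambda>k. g (8 * j + k)) |` {0..<8})"
    using s(2) path_over_unique unfolding child_def by metis
  then show "t \<in> ran g"
    unfolding ran_def restrict_map_def by (auto split: if_splits)
qed

lemma Gamma_parent:
  assumes "Gamma D E" "L \<in> D"
  obtains K where "K \<in> E" "segments L = {t. \<exists>s \<in> segments K. child s t}"
proof -
  have D: "D = Delta E" "disjoint_self_avoiding E"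
    using assms(1) Gamma.cases by blast+
  then obtain K f g where g: "L = curve_of g" "K \<in> E" "f \<in> K" "substitutes f g"
    using assms(2) unfolding Delta_def by blast
  then have "ran f = segments K"
    using D(2) ran_eq_segments unfolding disjoint_self_avoiding_def by blast
  then show ?thesis
    using that g ran_substitutes segments_curve_of by simp
qed

text \<open>Equality of the segment sets, not just inclusion, makes a curve recoverable from its
  ancestor.\<close>

lemma Gamma_iterate_ancestor:
  assumes "(Gamma ^^ n) D E" "L \<in> D"
  shows "\<exists>K \<in> E. segments L = {t. \<exists>s \<in> segments K. (child ^^ n) s t}"
  using assms
proof (induction n arbitrary: E)
  case 0
  then show ?case
    by auto
next
  case (Suc n)
  then obtain E' where E': "(Gamma ^^ n) D E'" "Gamma E' E"
    by auto
  with Suc obtain K' where K': "K' \<in> E'" "segments L = {t. \<exists>s \<in> segments K'. (child ^^ n) s t}"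
    by blast
  obtain K where K: "K \<in> E" "segments K' = {t. \<exists>s \<in> segments K. child s t}"
    using Gamma_parent[OF E'(2) K'(1)] by blast
  \<comment> \<open>\<open>Gamma\<close> leads back to ancestors while \<open>child\<close> leads to
    descendants, so the new generation is added at the opposite end of the power.\<close>
  have "child ^^ Suc n = child OO child ^^ n"
    by (simp add: relpowp_commute)
  then have "segments L = {t. \<exists>s \<in> segments K. (child ^^ Suc n) s t}"
    using K'(2) K(2) by (auto simp del: relpowp.simps)
  then show ?case
    using K(1) by blast
qed

section \<open>Contraction of midpoints towards the origin\<close>

fun norm_max :: "point \<Rightarrow> int" where
  "norm_max (a, b, c) = max \<bar>a\<bar> (max \<bar>b\<bar> \<bar>c\<bar>)"

fun norm_sum :: "point \<Rightarrow> int" where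
  "norm_sum (a, b, c) = \<bar>a\<bar> + \<bar>b\<bar> + \<bar>c\<bar>"

fun halve :: "point \<Rightarrow> point" where
  "halve (a, b, c) = (a div 2, b div 2, c div 2)"

text \<open>The only \<open>u\<close> for which the coordinates of \<open>8u + (a, b, c)\<close> can lie in \<open>[-2,2]\<close>.\<close>

fun nearest8 :: "point \<Rightarrow> point" where
  "nearest8 (a, b, c) = (- ((a + 2) div 8), - ((b + 2) div 8), - ((c + 2) div 8))"

text \<open>The first component is \<open>mid2\<close> of the segment being replaced, the second
  \<open>mid2\<close> of a segment of the path replacing it.\<close>

definition template_mids :: "(point \<times> point) list" where
  "template_mids = concat (map (\<lambda>vs. map (\<lambda>(p, q). (halve (vs ! 0 + vs ! 8), p + q))
     (zip vs (tl vs))) template_paths)"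

text \<open>Translating a path by \<open>4u\<close> moves the child by \<open>4u\<close> and the
  parent by \<open>2u\<close>; \<open>mid2\<close> doubles both shifts.\<close>

lemma child_mids:
  assumes "child s t"
  obtains u c d where "(c, d) \<in> set template_mids"
    "mid2 s = scale 4 u + c" "mid2 t = scale 8 u + d"
proof -
  obtain u vs ws where vs: "vs \<in> set template_paths" "ws = map ((+) (scale 4 u)) vs"
    "scale 2 ` s = {ws ! 0, ws ! 8}" and t: "t \<in> edges ws"
    using assms unfolding child_def path_over_def by blast
  note d = template_paths_distinct[OF vs(1)]
  obtain k where k: "k < 8" "t = {ws ! k, ws ! Suc k}"
    using t d vs(2) unfolding edges_def by auto
  define c where "c = halve (vs ! 0 + vs ! 8)"
  \<comment> \<open>The halving by \<open>div\<close> is exact on all templates.\<close>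
  have "list_all (\<lambda>vs. scale 2 (halve (vs ! 0 + vs ! 8)) = vs ! 0 + vs ! 8) template_paths"
    by code_simp
  then have "scale 2 c = vs ! 0 + vs ! 8"
    using vs(1) unfolding c_def list_all_iff by blast
  then have "scale 2 (mid2 s) = scale 2 (scale 4 u + c)"
    using mid2_path_over[OF vs] by (simp add: scale_add scale_scale)
  then have s: "mid2 s = scale 4 u + c"
    using inj_scale[of 2] by (simp add: inj_eq)
  have "ws ! k \<noteq> ws ! Suc k"
    using d vs(2) k(1) by (simp add: nth_eq_iff_index_eq)
  then have "mid2 t = (scale 4 u + scale 4 u) + (vs ! k + vs ! Suc k)"
    using k d(1) vs(2) by (simp add: mid2_doubleton add_ac)
  then have t: "mid2 t = scale 8 u + (vs ! k + vs ! Suc k)"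
    using scale_two[of "scale 4 u"] by (simp add: scale_scale)
  have "(vs ! k, vs ! Suc k) \<in> set (zip vs (tl vs))"
    using k(1) d(1) by (force simp: set_zip nth_tl)
  then have "(c, vs ! k + vs ! Suc k) \<in> set template_mids"
    using vs(1) unfolding template_mids_def c_def by force
  then show ?thesis
    using that s t by blast
qed

lemma child_norm_max:
  assumes "child s t"
  shows "2 * norm_max (mid2 s) \<le> norm_max (mid2 t) + 2"
proof -
  obtain u c d where cd: "(c, d) \<in> set template_mids"
    "mid2 s = scale 4 u + c" "mid2 t = scale 8 u + d"
    using child_mids[OF assms] by blast
  \<comment> \<open>The shifts \<open>8u\<close> and \<open>2 * 4u\<close> cancel in
    \<open>mid2 t - 2 mid2 s\<close>, so a check of the table covers all translates.\<close>
  have "list_all (\<lambda>(c, d). norm_max (d - scale 2 c) \<le> 2) template_mids"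
    by code_simp
  then have "norm_max (d - scale 2 c) \<le> 2"
    using cd(1) by (auto simp: list_all_iff)
  then have *: "norm_max (mid2 t - scale 2 (mid2 s)) \<le> 2"
    using cd(2,3) by (simp add: scale_add scale_scale)
  obtain x y z where s: "mid2 s = (x, y, z)"
    by (cases "mid2 s")
  obtain x' y' z' where t: "mid2 t = (x', y', z')"
    by (cases "mid2 t")
  have "2 * \<bar>x\<bar> \<le> \<bar>x'\<bar> + 2" "2 * \<bar>y\<bar> \<le> \<bar>y'\<bar> + 2" "2 * \<bar>z\<bar> \<le> \<bar>z'\<bar> + 2"
    using * unfolding s t by (auto simp: scale_def)
  then show ?thesis
    unfolding s t by (simp add: max_def)
qed

text \<open>Among the segments of the cube \<open>[-1,1]\<^sup>3\<close>, the sum norm of \<open>mid2\<close> is 1 for those at the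
  origin, 3 for those joining the centre of a face to an edge of the cube, and 5 for those lying on
  an edge of the cube. The latter turn out to have no descendants in the cube.\<close>

lemma child_in_cube:
  assumes "child s t" "norm_max (mid2 t) \<le> 2"
  shows "norm_sum (mid2 s) = 1 \<or> norm_sum (mid2 s) = 3 \<and> norm_sum (mid2 t) = 5"
proof -
  obtain u c d where cd: "(c, d) \<in> set template_mids"
    "mid2 s = scale 4 u + c" "mid2 t = scale 8 u + d"
    using child_mids[OF assms(1)] by blast
  have "list_all (\<lambda>(c, d). let u = nearest8 d; a = scale 4 u + c; b = scale 8 u + d in
      norm_max b \<le> 2 \<longrightarrow> norm_sum a = 1 \<or> norm_sum a = 3 \<and> norm_sum b = 5) template_mids"
    by code_simp
  moreover have "u = nearest8 d"
  proof -
    have "x = - ((y + 2) div 8)" if "\<bar>8 * x + y\<bar> \<le> 2" for x y :: int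
      using that by presburger
    then show ?thesis
      using assms(2) cd(3) by (cases u; cases d) (auto simp: scale_def)
  qed
  ultimately show ?thesis
    using cd assms(2) by (auto simp: list_all_iff Let_def)
qed

text \<open>A step back takes a norm \<open>N\<close> to at most \<open>N/2 + 1\<close>. For an
  integer \<open>N > 2\<close> this is a drop by at least one, and the bound 2 is preserved.\<close>

lemma ancestor_in_cube:
  assumes "(child ^^ n) s t" "norm_max (mid2 t) \<le> int n + 2"
  shows "norm_max (mid2 s) \<le> 2"
  using assms
proof (induction n arbitrary: t)
  case 0
  then show ?case
    by simp
next
  case (Suc n)
  then obtain r where "(child ^^ n) s r" "child r t"
    by auto
  then show ?case
    using Suc child_norm_max[of r t] by force
qed

lemma ancestor_at_origin:
  assumes "(child ^^ n) s t" "norm_max (mid2 t) + 2 \<le> int n"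
  shows "norm_sum (mid2 s) = 1"
proof -
  have "0 \<le> norm_max (mid2 t)"
    by (cases "mid2 t") simp
  then have "2 \<le> n"
    using assms(2) by linarith
  \<comment> \<open>The two oldest generations are set aside for the passage from the cube to the
    origin.\<close>
  then obtain m where m: "n = Suc (Suc m)"
    by (metis add_2_eq_Suc le_Suc_ex)
  obtain q r where "child s q" "child q r" "(child ^^ m) r t"
    using assms(1) unfolding m by (metis relpowp_Suc_E2)
  have "norm_max (mid2 r) \<le> 2"
    using ancestor_in_cube[OF \<open>(child ^^ m) r t\<close>] assms(2) m by simp
  \<comment> \<open>As a parent of \<open>r\<close>, \<open>q\<close> has sum norm 1 or 3; this
    excludes the second alternative for \<open>s\<close>.\<close>
  then have "norm_sum (mid2 q) \<noteq> 5" "norm_max (mid2 q) \<le> 2"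
    using child_in_cube[OF \<open>child q r\<close>] child_norm_max[OF \<open>child q r\<close>] by auto
  then show ?thesis
    using child_in_cube[OF \<open>child s q\<close>] by blast
qed

section \<open>Counting the ancestors\<close>

lemma inj_on_mid2: "inj_on mid2 (Collect is_segment)"
proof (rule inj_onI; clarify)
  fix s t assume "is_segment s" "is_segment t" "mid2 s = mid2 t"
  then obtain x e y f where e: "e \<in> {(1, 0, 0), (0, 1, 0), (0, 0, 1)}" "s = {x, x + e}"
    and f: "f \<in> {(1, 0, 0), (0, 1, 0), (0, 0, 1)}" "t = {y, y + f}"
    unfolding is_segment_def by blast
  have "x \<noteq> x + e" "y \<noteq> y + f"
    using e(1) f(1) by (auto simp: zero_prod_def)
  then have "x + (x + e) = y + (y + f)"
    using \<open>mid2 s = mid2 t\<close> e(2) f(2) mid2_doubleton by simp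
  \<comment> \<open>The only odd coordinate of \<open>2x + e\<close> reveals the direction
    \<open>e\<close>.\<close>
  then have "x = y \<and> e = f"
    using e(1) f(1) by (cases x; cases y) (auto; presburger)
  then show "s = t"
    using e f by simp
qed

theorem corollary2p11:
  fixes D :: "curve set"
  assumes "disjoint_self_avoiding D"
    and "\<forall>K \<in> D. without_endpoints K"
    and "\<forall>n. Gamma_iterate_defined n D"
  shows "finite D \<and> card D \<le> 27"
proof (rule finite_if_finite_subsets_card_bdd)
  \<comment> \<open>Finiteness of \<open>F\<close> permits one \<open>n\<close> for all its
    curves.\<close>
  fix F assume "F \<subseteq> D" "finite F"
  have "\<forall>L \<in> F. \<exists>t. t \<in> segments L"
    using assms(1) \<open>F \<subseteq> D\<close> segments_nonempty unfolding disjoint_self_avoiding_def by blast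
  then obtain t where t: "t L \<in> segments L" if "L \<in> F" for L
    by metis
  \<comment> \<open>The sum dominates each of its terms. \<open>Suc\<close> guarantees at least one
    application of \<open>Gamma\<close>, which makes \<open>E\<close> disjoint and
    self-avoiding.\<close>
  define n where "n = Suc (\<Sum>L\<in>F. nat (norm_max (mid2 (t L)) + 2))"
  have n: "norm_max (mid2 (t L)) + 2 \<le> int n" if "L \<in> F" for L
  proof -
    have "nat (norm_max (mid2 (t L)) + 2) \<le> n"
      using member_le_sum[of L F "\<lambda>L. nat (norm_max (mid2 (t L)) + 2)"] that \<open>finite F\<close>
      unfolding n_def by (simp add: le_SucI)
    then show ?thesis
      by linarith
  qed
  obtain E where E: "(Gamma ^^ n) D E"
    using assms(3) Gamma_iterate_defined_def by blast
  then have disj: "disjoint_self_avoiding E"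
    unfolding n_def using Gamma.cases by (metis relpowp_Suc_E)
  have "\<forall>L \<in> F. \<exists>K. K \<in> E \<and> segments L = {t. \<exists>s \<in> segments K. (child ^^ n) s t}"
    using Gamma_iterate_ancestor[OF E] \<open>F \<subseteq> D\<close> by blast
  from bchoice[OF this] obtain \<phi> where \<phi>: "\<phi> L \<in> E"
    "segments L = {t. \<exists>s \<in> segments (\<phi> L). (child ^^ n) s t}" if "L \<in> F" for L
    by blast
  then have "\<forall>L \<in> F. \<exists>s \<in> segments (\<phi> L). (child ^^ n) s (t L)"
    using t by blast
  then obtain s where s: "s L \<in> segments (\<phi> L)" "(child ^^ n) (s L) (t L)" if "L \<in> F" for L
    by metis
  have seg: "is_segment (s L)" if "L \<in> F" for L
    using segments_is_segment disj \<phi>(1) s(1) that unfolding disjoint_self_avoiding_def by blast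
  have "inj_on (\<lambda>L. mid2 (s L)) F"
  proof (rule inj_onI)
    fix L L' assume L: "L \<in> F" "L' \<in> F" "mid2 (s L) = mid2 (s L')"
    then have "s L = s L'"
      using inj_on_mid2 seg by (auto simp: inj_on_def)
    then have "\<phi> L = \<phi> L'"
      using curve_with_segment_unique[OF disj] \<phi>(1) s(1) L by metis
    \<comment> \<open>The same ancestor has the same set of descendants.\<close>
    then have "t L \<in> segments L'"
      using \<phi>(2)[OF L(1)] \<phi>(2)[OF L(2)] t[OF L(1)] by simp
    then show "L = L'"
      using curve_with_segment_unique[OF assms(1)] t L \<open>F \<subseteq> D\<close> by blast
  qed
  \<comment> \<open>Sum norm 1 means a unit vector up to sign, hence one of the 27 points of this
    cube.\<close>
  moreover have "mid2 (s L) \<in> {-1..1} \<times> {-1..1} \<times> {-1..1}" if "L \<in> F" for L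
    using ancestor_at_origin[OF s(2)[OF that] n[OF that]] by (cases "mid2 (s L)") auto
  ultimately have "card F \<le> card ({-1..1::int} \<times> {-1..1::int} \<times> {-1..1::int})"
    by (intro card_inj_on_le[of "\<lambda>L. mid2 (s L)"] image_subsetI) auto
  then show "card F \<le> 27"
    by simp
qed

end
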